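(* Let $r\geq 1$ be an integer. Let $c_k^{(r)}(q)$, $k=0,1,2,\ldots$, be the rational functions of $q$ (not depending on $n$) determined by the requirement that for every integer $n\geq 0$ $$\sum_{k=0}^n q^{r\binom{n-k}{2}+(1-r)\binom{n}{2}}{n\brack k}^r{n+k\brack k}^r=\sum_{k=0}^n q^{\binom{n-k}{2}+(1-r)\binom{k}{2}}{n\brack k}{n+k\brack k}c_k^{(r)}(q).$$ Then $c_n^{(r)}(q)\in\mathbb{N}[q]$ for every $n\ge 0$, i.e. it is a polynomial in $q$ with nonnegative integer coefficients.
   Context: For an integer $n\ge 0$, $(q)_n=(1-q)(1-q^2)\cdots(1-q^n)$ (with $(q)_0=1$). The $q$-binomial coefficient is ${n\brack k}=\frac{(q)_n}{(q)_k(q)_{n-k}}$ for $0\le k\le n$, and $0$ otherwise. Note that the displayed identity for successive $n$ determines the $c_n^{(r)}(q)$ recursively and uniquely, since the coefficient of $c_n^{(r)}(q)$ in the $n$-th identity is the nonzero quantity $q^{(1-r)\binom n2}{2n\brack n}$. *)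

theory Defs
  imports "HOL-Computational_Algebra.Polynomial_Factorial"
begin

text \<open>Rational functions in the indeterminate \<open>q\<close>: the field \<open>Frac(\<rat>[q])\<close>.\<close>

type_synonym ratfun = "rat poly fract"

definition qvar :: ratfun where
  "qvar = to_fract [:0, 1:]"

definition qfact :: "nat \<Rightarrow> ratfun" where
  "qfact n = (\<Prod>i=1..n. 1 - qvar ^ i)"

definition qbinom :: "nat \<Rightarrow> nat \<Rightarrow> ratfun" where
  "qbinom n k = (if k \<le> n then qfact n / (qfact k * qfact (n - k)) else 0)"

text \<open>The semiring \<open>\<nat>[q]\<close>, as a subset of the field of rational functions.\<close>

definition nat_polys :: "ratfun set" where
  "nat_polys = range (\<lambda>p :: nat poly. to_fract (map_poly of_nat p))"

text \<open>The exponents of \<open>q\<close> may be negative, hence integer powers (\<open>powi\<close>) and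
  \<open>1 - int r\<close> rather than truncated subtraction.\<close>

definition schmidt_identity :: "nat \<Rightarrow> (nat \<Rightarrow> ratfun) \<Rightarrow> nat \<Rightarrow> bool" where
  "schmidt_identity r c n \<longleftrightarrow>
     (\<Sum>k=0..n. qvar powi (int r * int ((n - k) choose 2) + (1 - int r) * int (n choose 2))
                  * qbinom n k ^ r * qbinom (n + k) k ^ r)
   = (\<Sum>k=0..n. qvar powi (int ((n - k) choose 2) + (1 - int r) * int (k choose 2))
                  * qbinom n k * qbinom (n + k) k * c k)"

text \<open>The identities for all \<open>n\<close> determine the sequence \<open>c\<close> (existence and uniqueness).\<close>

lemma qvar_power: "qvar ^ i = to_fract (monom 1 i)"
proof (induction i)
  case (Suc i)
  have "monom 1 (Suc i) = [:0, 1:] * (monom 1 i :: rat poly)"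
    by (simp add: monom_Suc)
  then show ?case
    using Suc by (simp only: power_Suc qvar_def to_fract_mult)
qed simp

lemma qvar_nonzero: "qvar \<noteq> 0"
  by (simp add: qvar_def)

lemma qfact_nonzero: "qfact n \<noteq> 0"
proof -
  have "1 - qvar ^ i \<noteq> 0" if "i \<ge> 1" for i
  proof
    assume "1 - qvar ^ i = 0"
    then have "to_fract (monom 1 i) = (to_fract 1 :: ratfun)"
      by (simp add: qvar_power)
    then have "monom 1 i = (1 :: rat poly)"
      by (simp only: to_fract_eq_iff)
    then have "degree (monom (1::rat) i) = 0"
      by simp
    with that show False
      by (simp add: degree_monom_eq)
  qed
  then show ?thesis
    by (auto simp: qfact_def)
qed

lemma triangular_system_ex1:
  fixes a :: "nat \<Rightarrow> nat \<Rightarrow> 'a :: field"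
  assumes nz: "\<And>n. a n n \<noteq> 0"
  shows "\<exists>!c. \<forall>n. s n = (\<Sum>k=0..n. a n k * c k)"
proof -
  have *: "s n = (\<Sum>k=0..n. a n k * c k) \<longleftrightarrow> c n = (s n - (\<Sum>k<n. a n k * c k)) / a n n" for c n
  proof -
    have "(\<Sum>k=0..n. a n k * c k) = (\<Sum>k<n. a n k * c k) + a n n * c n"
      by (simp only: atLeast0AtMost lessThan_Suc_atMost[symmetric] sum.lessThan_Suc)
    then show ?thesis
      using nz[of n] by (auto simp: nonzero_eq_divide_eq algebra_simps)
  qed
  define F where "F = (\<lambda>c n. (s n - (\<Sum>k<n. a n k * c k)) / a n n)"
  define c where "c = wfrec less_than F"
  have c: "c n = F c n" for n
  proof -
    have "c n = F (cut c less_than n) n"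
      unfolding c_def by (rule wfrec) simp
    also have "\<dots> = F c n"
      by (simp add: F_def cut_def)
    finally show ?thesis .
  qed
  show ?thesis
  proof (rule ex1I[of _ c])
    show "\<forall>n. s n = (\<Sum>k=0..n. a n k * c k)"
      unfolding * using c unfolding F_def by blast
  next
    fix d assume "\<forall>n. s n = (\<Sum>k=0..n. a n k * d k)"
    then have d: "d n = F d n" for n
      unfolding * F_def by blast
    have "d n = c n" for n
    proof (induction n rule: less_induct)
      case (less n)
      have "F d n = F c n"
        using less by (simp add: F_def)
      with d c show ?case
        by metis
    qed
    then show "d = c"
      by blast
  qed
qed

lemma schmidt_identity_ex1: "\<exists>!c. \<forall>n. schmidt_identity r c n"
  unfolding schmidt_identity_def
  by (rule triangular_system_ex1) (simp add: qbinom_def qfact_nonzero qvar_nonzero)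

end

theory Submission imports Defs begin

text \<open>
  Put \<open>Q\<^sub>k = q^(C(n-k,2) - C(n,2)) [n,k] [n+k,k]\<close>. After division by \<open>q^C(n,2)\<close> the identity reads
  \<open>\<Sum>\<^sub>k Q\<^sub>k^r = \<Sum>\<^sub>m q^((1-r) C(m,2)) c\<^sub>m Q\<^sub>m\<close>. Up to normalisation \<open>Q\<^sub>k\<close> is the polynomial
  \<open>\<Prod>\<^sub>i (x - q^i - q^(1-i))\<close>, \<open>1 \<le> i \<le> k\<close>, in \<open>x = q^(-n) + q^(n+1)\<close>, so products of the \<open>Q\<^sub>k\<close>
  expand in the \<open>Q\<^sub>m\<close> with coefficients independent of \<open>n\<close> (a form of the q-Pfaff-Saalschuetz sum):
  \<open>Q\<^sub>j Q\<^sub>k = \<Sum>\<^sub>m q^(-C(m,2)) M(j,k,m) Q\<^sub>m\<close> with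
  \<open>M(j,k,m) = q^(C(m-j,2) + C(m-k,2)) [k,m-j] [j+k,j] [m,k]\<close>, which lies in \<open>\<nat>[q]\<close>.
  Iterating gives \<open>Q\<^sub>k^r = \<Sum>\<^sub>m q^((1-r) C(m,2)) d(k,m) Q\<^sub>m\<close> with \<open>d(k,m) \<in> \<nat>[q]\<close>, because
  only \<open>j \<le> m\<close> contribute and so the powers of \<open>q\<close> that arise are nonnegative.
  Hence \<open>c\<^sub>m = \<Sum>\<^sub>k d(k,m)\<close>.
\<close>

section \<open>Closure properties of the semiring N[q]\<close>

lemma map_poly_of_nat_add:
  "map_poly of_nat (p + q) = (map_poly of_nat p + map_poly of_nat q :: 'a :: semiring_1 poly)"
  by (simp add: poly_eq_iff coeff_map_poly)

lemma map_poly_of_nat_mult: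
  "map_poly of_nat (p * q) = (map_poly of_nat p * map_poly of_nat q :: 'a :: comm_semiring_1 poly)"
  by (simp add: poly_eq_iff coeff_map_poly coeff_mult)

lemma nat_polys_0: "0 \<in> nat_polys"
  unfolding nat_polys_def by (rule range_eqI[of _ _ 0]) simp

lemma nat_polys_add: "x \<in> nat_polys \<Longrightarrow> y \<in> nat_polys \<Longrightarrow> x + y \<in> nat_polys"
  unfolding nat_polys_def
  by (auto simp: map_poly_of_nat_add[symmetric] simp flip: to_fract_add)

lemma nat_polys_mult: "x \<in> nat_polys \<Longrightarrow> y \<in> nat_polys \<Longrightarrow> x * y \<in> nat_polys"
  unfolding nat_polys_def
  by (auto simp: map_poly_of_nat_mult[symmetric] simp flip: to_fract_mult)

lemma nat_polys_sum: "(\<And>i. i \<in> A \<Longrightarrow> f i \<in> nat_polys) \<Longrightarrow> sum f A \<in> nat_polys"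
  by (induction A rule: infinite_finite_induct) (auto intro: nat_polys_0 nat_polys_add)

lemma nat_polys_qvar_power: "qvar ^ i \<in> nat_polys"
  unfolding nat_polys_def qvar_power
  by (rule range_eqI[of _ _ "monom 1 i"]) (simp add: map_poly_monom)

lemma nat_polys_1: "1 \<in> nat_polys"
  using nat_polys_qvar_power[of 0] by simp

section \<open>q-factorials and q-binomial coefficients\<close>

lemma qfact_Suc: "qfact (Suc n) = (1 - qvar ^ Suc n) * qfact n"
  by (simp add: qfact_def mult.commute)

lemma one_minus_qvar_power_nonzero: "1 - qvar ^ Suc n \<noteq> 0"
  using qfact_nonzero[of "Suc n"] by (simp only: qfact_Suc) auto

lemma qbinom_Suc_Suc: "qbinom (Suc n) (Suc k) = qbinom n k + qvar ^ Suc k * qbinom n (Suc k)"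
proof (cases "Suc k \<le> n")
  case True
  then obtain d where n: "n = k + Suc d"
    by (metis Suc_le_eq add_Suc_right less_imp_Suc_add)
  have pow: "qvar ^ Suc n = qvar ^ Suc k * qvar ^ Suc d"
    by (simp only: n power_add[symmetric]) simp
  have b1: "qbinom (Suc n) (Suc k) =
      (1 - qvar ^ Suc n) * qfact n / ((1 - qvar ^ Suc k) * qfact k * ((1 - qvar ^ Suc d) * qfact d))"
    by (simp only: qbinom_def qfact_Suc[symmetric]) (simp add: n)
  have b2: "qbinom n k = qfact n / (qfact k * ((1 - qvar ^ Suc d) * qfact d))"
    by (simp only: qbinom_def qfact_Suc[symmetric]) (simp add: n)
  have b3: "qbinom n (Suc k) = qfact n / ((1 - qvar ^ Suc k) * qfact k * qfact d)"
    by (simp only: qbinom_def qfact_Suc[symmetric]) (simp add: n)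
  show ?thesis
    unfolding b1 b2 b3 pow using one_minus_qvar_power_nonzero[of k] one_minus_qvar_power_nonzero[of d]
      qfact_nonzero[of k] qfact_nonzero[of d]
    by (simp del: power_Suc add: divide_simps) (simp del: power_Suc add: algebra_simps)
next
  case False
  then show ?thesis
    by (cases "k = n") (auto simp: qbinom_def qfact_nonzero qfact_def[of 0])
qed

text \<open>Positivity, hidden in the quotient of q-factorials, is visible in the q-Pascal rule: its
  coefficients 1 and \<open>qvar ^ Suc k\<close> lie in N[q].\<close>

lemma qbinom_nat_polys: "qbinom n k \<in> nat_polys"
proof (induction n arbitrary: k)
  case 0
  show ?case
    by (cases k) (auto simp: qbinom_def qfact_def intro: nat_polys_0 nat_polys_1)
next
  case (Suc n)
  show ?case
  proof (cases k)
    case 0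
    then show ?thesis by (simp add: qbinom_def qfact_nonzero qfact_def[of 0] nat_polys_1)
  next
    case (Suc l)
    then show ?thesis
      by (simp only: qbinom_Suc_Suc Suc.IH nat_polys_add nat_polys_mult nat_polys_qvar_power)
  qed
qed

section \<open>Expansion coefficients of the products and their recurrence\<close>

text \<open>The convention that \<open>1/(q)\<^sub>i\<close> vanishes for \<open>i < 0\<close> makes \<open>inv_qfact_pred\<close> hold for all
  integers, so that the recurrence for \<open>prod_coeff\<close> needs no case distinction on the support.\<close>

definition inv_qfact :: "int \<Rightarrow> ratfun" where
  "inv_qfact i = (if i < 0 then 0 else inverse (qfact (nat i)))"

lemma inv_qfact_of_nat [simp]: "inv_qfact (int n) = inverse (qfact n)"
  by (simp add: inv_qfact_def)

lemma inv_qfact_pred: "inv_qfact (i - 1) = (1 - qvar powi i) * inv_qfact i"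
proof (cases "i \<ge> 1")
  case True
  then obtain n where i: "i = int (Suc n)"
    by (metis Suc_pred' zero_less_imp_eq_int int_one_le_iff_zero_less)
  have "i - 1 = int n" by (simp add: i)
  then show ?thesis
    unfolding i inv_qfact_of_nat power_int_of_nat qfact_Suc
    using one_minus_qvar_power_nonzero[of n] qfact_nonzero[of n]
    by (simp only: inv_qfact_of_nat) (simp add: field_simps)
next
  case False
  then show ?thesis by (cases "i = 0") (auto simp: inv_qfact_def)
qed

text \<open>The coefficient of Q_m in Q_j Q_k, in a form symmetric in \<open>j\<close> and
  \<open>k\<close>. The three \<open>inv_qfact\<close> factors confine the support to max(j,k) \<le>
  m \<le> j+k.\<close>

definition prod_coeff :: "nat \<Rightarrow> nat \<Rightarrow> nat \<Rightarrow> ratfun" where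
  "prod_coeff j k m =
     qvar powi (int (Suc j choose 2) + int (Suc k choose 2) - int (Suc m choose 2)
                 - (int j + int k - int m) * int m)
     * qfact (j + k) * qfact m / (qfact j * qfact k)
     * inv_qfact (int m - int j) * inv_qfact (int m - int k) * inv_qfact (int j + int k - int m)"

text \<open>This is the recurrence in \<open>k\<close> that comparing coefficients in \<open>product_expansion\<close> forces.
  With \<open>A = q^j\<close>, \<open>B = q^(k+1)\<close>, \<open>X = q^(m+1)\<close> it reduces to
  \<open>(1 - B) (1 - AB) = (AB/X) (1 - X) (1 - X/A) + (1 - XB) (1 - AB/X)\<close>.\<close>

lemma prod_coeff_Suc_Suc:
  "(1 - qvar ^ Suc k)^2 * prod_coeff j (Suc k) (Suc m) =
     qvar powi (int k - int m) * (1 - qvar ^ Suc m)^2 * prod_coeff j k m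
     + qvar powi (int k - int m) * (1 - qvar powi (int (Suc m) - int k))
       * (1 - qvar ^ (m + k + 2)) * prod_coeff j k (Suc m)"
proof -
  define A B X where "A = qvar ^ j" and "B = qvar ^ Suc k" and "X = qvar ^ Suc m"
  have nz: "A \<noteq> 0" "B \<noteq> 0" "X \<noteq> 0" "qvar \<noteq> 0"
    by (simp_all add: A_def B_def X_def qvar_nonzero)
  define e where "e = int (Suc j choose 2) + int (Suc k choose 2) - int (Suc m choose 2)
                 - (int j + int k - int m) * int m"
  define E where "E = qvar powi e"
  \<comment> \<open>Each is taken at the largest argument that occurs, so
    \<open>inv_qfact_pred\<close> turns all three coefficients into multiples of
    \<open>u * v * w\<close>.\<close>
  define u v w where "u = inv_qfact (int (Suc m) - int j)"
    and "v = inv_qfact (int (Suc m) - int k)" and "w = inv_qfact (int j + int k - int m)"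
  have pow: "qvar powi (int (Suc m) - int j) = X / A"
    "qvar powi (int (Suc m) - int k) = qvar * X / B"
    "qvar powi (int j + int k - int m) = A * B / X"
    "qvar powi (int k - int m) = B / X"
    using nz(4) by (simp_all add: A_def B_def X_def power_int_diff power_int_add)
  have pow': "qvar ^ (m + k + 2) = X * B"
    by (simp add: X_def B_def power_add power2_eq_square)
  have u: "inv_qfact (int m - int j) = (1 - X / A) * u"
    using inv_qfact_pred[of "int (Suc m) - int j", unfolded pow] by (simp add: u_def)
  have v: "inv_qfact (int m - int k) = (1 - qvar * X / B) * v"
    using inv_qfact_pred[of "int (Suc m) - int k", unfolded pow] by (simp add: v_def)
  have w: "inv_qfact (int j + int k - int (Suc m)) = (1 - A * B / X) * w"
    using inv_qfact_pred[of "int j + int k - int m", unfolded pow]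
    by (simp add: w_def algebra_simps)
  have ind: "int (Suc m) - int (Suc k) = int m - int k"
    "int j + int (Suc k) - int (Suc m) = int j + int k - int m" by simp_all
  have exps: "int (Suc j choose 2) + int (Suc (Suc k) choose 2) - int (Suc (Suc m) choose 2)
                 - (int j + int k - int m) * int (Suc m) = e - int j"
    "int (Suc j choose 2) + int (Suc k choose 2) - int (Suc (Suc m) choose 2)
                 - (int j + int k - int (Suc m)) * int (Suc m) = e - (int j + int k - int m)"
    by (simp_all add: e_def numeral_2_eq_2 algebra_simps)
  have E: "qvar powi (e - int j) = E / A"
    "qvar powi (e - (int j + int k - int m)) = E * X / (A * B)"
    using nz(4) pow(3) by (simp_all add: E_def power_int_diff A_def del: power_int_of_nat)
      (simp add: power_int_of_nat)
  have L: "prod_coeff j k m = E * qfact (j + k) * qfact m / (qfact j * qfact k)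
      * ((1 - X / A) * u) * ((1 - qvar * X / B) * v) * w"
    unfolding prod_coeff_def u v w_def E_def e_def ..
  have L1: "prod_coeff j (Suc k) (Suc m) =
      E / A * ((1 - A * B) * qfact (j + k)) * ((1 - X) * qfact m) / (qfact j * ((1 - B) * qfact k))
      * u * ((1 - qvar * X / B) * v) * w"
  proof -
    have "qfact (j + Suc k) = (1 - A * B) * qfact (j + k)"
      using qfact_Suc[of "j + k"] by (simp add: A_def B_def power_add mult_ac)
    then show ?thesis
      unfolding prod_coeff_def ind exps E qfact_Suc B_def[symmetric] X_def[symmetric] v w_def u_def
      by simp
  qed
  have L2: "prod_coeff j k (Suc m) =
      E * X / (A * B) * qfact (j + k) * ((1 - X) * qfact m) / (qfact j * qfact k)
      * u * v * ((1 - A * B / X) * w)"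
    unfolding prod_coeff_def exps E qfact_Suc X_def[symmetric] w u_def v_def ..
  have B1: "1 - B \<noteq> 0"
    using one_minus_qvar_power_nonzero[of k] by (simp add: B_def)
  \<comment> \<open>The factor shared by all three terms; \<open>1 - qvar * X / B\<close> comes from
    \<open>v\<close> in two of them and from the recurrence itself in the third.\<close>
  define G where "G = E * qfact (j + k) * qfact m / (qfact j * qfact k)
    * u * v * w * (1 - X) * (1 - qvar * X / B)"
  have "(1 - B)^2 * prod_coeff j (Suc k) (Suc m) = G * ((1 - B) * (1 - A * B) / A)"
    unfolding L1 G_def using nz B1 qfact_nonzero[of j] qfact_nonzero[of k]
    by (simp add: divide_simps power2_eq_square)
  also have "(1 - B) * (1 - A * B) / A =
      B / X * (1 - X) * (1 - X / A) + (1 - X * B) * (1 - A * B / X) / A"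
    using nz by (simp add: divide_simps) (simp add: algebra_simps)
  also have "G * \<dots> = B / X * (1 - X)^2 * prod_coeff j k m
      + B / X * (1 - qvar * X / B) * (1 - X * B) * prod_coeff j k (Suc m)"
  proof -
    have "G * (B / X * (1 - X) * (1 - X / A)) = B / X * (1 - X)^2 * prod_coeff j k m"
      unfolding L G_def by (simp add: power2_eq_square mult_ac)
    moreover have "G * ((1 - X * B) * (1 - A * B / X) / A) =
        B / X * (1 - qvar * X / B) * (1 - X * B) * prod_coeff j k (Suc m)"
    proof -
      have "B / X * (E * X / (A * B)) = E / A"
        using nz by simp
      then show ?thesis
        unfolding L2 G_def using nz by (simp add: mult_ac)
    qed
    ultimately show ?thesis
      by (simp only: distrib_left)
  qed
  finally show ?thesis
    by (simp only: pow pow' B_def[symmetric] X_def[symmetric])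
qed

lemma prod_coeff_0_right: "m \<le> j \<Longrightarrow> prod_coeff j 0 m = (if m = j then 1 else 0)"
  by (auto simp: prod_coeff_def inv_qfact_def qfact_nonzero qfact_def[of 0] numeral_2_eq_2)

lemma prod_coeff_eq_0: "j + k < m \<Longrightarrow> prod_coeff j k m = 0"
  by (simp add: prod_coeff_def inv_qfact_def)

text \<open>The recurrence at m = -1, without its first term. Both sides vanish because an
  \<open>inv_qfact\<close> has a negative argument, except that for k = 0 the right side vanishes
  through \<open>1 - qvar powi 0\<close>.\<close>

lemma prod_coeff_Suc_0:
  "(1 - qvar ^ Suc k)^2 * prod_coeff j (Suc k) 0 =
     qvar powi (int k + 1) * (1 - qvar powi (- int k)) * (1 - qvar ^ (k + 1)) * prod_coeff j k 0"
  by (cases "k = 0") (simp_all add: prod_coeff_def inv_qfact_def)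

text \<open>Multiplying by the factor that leads from Q_k to Q_(k+1) sends each Q_m to a combination
  of Q_(m+1) and Q_m with coefficients free of \<open>x\<close>; the recurrence for
  \<open>prod_coeff\<close> records exactly this.\<close>

lemma product_expansion:
  fixes Q :: "nat \<Rightarrow> ratfun"
  assumes Q0: "Q 0 = 1"
    and rec: "\<And>k. (1 - qvar ^ Suc k)^2 * Q (Suc k)
                    = (qvar ^ Suc k * x - qvar ^ (2 * Suc k) - qvar) * Q k"
  shows "Q j * Q k = (\<Sum>m\<le>j + k. prod_coeff j k m * Q m)"
proof (induction k)
  case 0
  have "(\<Sum>m\<le>j + 0. prod_coeff j 0 m * Q m) = (\<Sum>m\<le>j. if m = j then Q m else 0)"
    by (intro sum.cong) (auto simp: prod_coeff_0_right)
  then show ?case by (simp add: Q0)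
next
  case (Suc k)
  define t where "t m = qvar powi (int k - int m)" for m
  define r where "r m = qvar powi (int k + 1 - int m) * (1 - qvar powi (int m - int k))
    * (1 - qvar ^ (m + k + 1))" for m
  define f where "f m = t m * (1 - qvar ^ Suc m)^2 * prod_coeff j k m" for m
  define g where "g m = r m * prod_coeff j k m" for m
  define h where "h m = (1 - qvar ^ Suc k)^2 * prod_coeff j (Suc k) m" for m
  \<comment> \<open>Both brackets are linear in \<open>x\<close>; \<open>t m\<close> is the ratio of
    their leading coefficients and \<open>r m\<close> the remainder, which is free of
    \<open>x\<close>.\<close>
  have split: "qvar ^ Suc k * x - qvar ^ (2 * Suc k) - qvar
      = t m * (qvar ^ Suc m * x - qvar ^ (2 * Suc m) - qvar) + r m" for m
  proof -
    define K M where "K = qvar ^ k" and "M = qvar ^ m"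
    have nz: "K \<noteq> 0" "M \<noteq> 0" by (simp_all add: K_def M_def qvar_nonzero)
    have t: "t m = K / M"
      by (simp add: t_def K_def M_def power_int_diff qvar_nonzero)
    have "qvar powi (int k + 1 - int m) = qvar * K / M"
      by (simp add: K_def M_def power_int_diff power_int_add qvar_nonzero)
    moreover have "qvar powi (int m - int k) = M / K"
      by (simp add: K_def M_def power_int_diff qvar_nonzero)
    moreover have "qvar ^ (m + k + 1) = qvar * M * K"
      by (simp add: K_def M_def power_add)
    ultimately have r: "r m = qvar * K / M * (1 - M / K) * (1 - qvar * M * K)"
      by (simp only: r_def)
    have pows: "qvar ^ Suc k = qvar * K" "qvar ^ (2 * Suc k) = (qvar * K)^2"
      "qvar ^ Suc m = qvar * M" "qvar ^ (2 * Suc m) = (qvar * M)^2"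
      by (simp_all add: K_def M_def power_mult_distrib power_even_eq power2_eq_square power_add
          mult_2)
    show ?thesis
      unfolding t r pows using nz
      by (simp add: divide_simps) (simp add: algebra_simps power2_eq_square)
  qed
  have h_Suc: "h (Suc m) = f m + g (Suc m)" for m
    using prod_coeff_Suc_Suc[of k j m] by (simp add: h_def f_def g_def t_def r_def)
  have h_0: "h 0 = g 0"
    using prod_coeff_Suc_0[of k j] by (simp add: h_def g_def r_def)
  have g_top: "g (Suc (j + k)) = 0"
    by (simp add: g_def prod_coeff_eq_0)
  have "(1 - qvar ^ Suc k)^2 * (Q j * Q (Suc k))
      = Q j * ((1 - qvar ^ Suc k)^2 * Q (Suc k))"
    by (simp only: mult_ac)
  also have "\<dots> = (qvar ^ Suc k * x - qvar ^ (2 * Suc k) - qvar) * (Q j * Q k)"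
    unfolding rec by (simp only: mult_ac)
  also have "\<dots> = (\<Sum>m\<le>j + k. (qvar ^ Suc k * x - qvar ^ (2 * Suc k) - qvar) * (prod_coeff j k m * Q m))"
    unfolding Suc.IH sum_distrib_left ..
  also have "\<dots> = (\<Sum>m\<le>j + k. f m * Q (Suc m) + g m * Q m)"
  proof (rule sum.cong[OF refl])
    fix m
    have "(qvar ^ Suc k * x - qvar ^ (2 * Suc k) - qvar) * (prod_coeff j k m * Q m)
        = prod_coeff j k m * (t m * ((qvar ^ Suc m * x - qvar ^ (2 * Suc m) - qvar) * Q m) + r m * Q m)"
      unfolding split[of m] by (simp only: distrib_left distrib_right mult_ac)
    also have "\<dots> = f m * Q (Suc m) + g m * Q m"
      unfolding rec[symmetric] f_def g_def by (simp only: distrib_left mult_ac)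
    finally show "(qvar ^ Suc k * x - qvar ^ (2 * Suc k) - qvar) * (prod_coeff j k m * Q m)
        = f m * Q (Suc m) + g m * Q m" .
  qed
  \<comment> \<open>As \<open>g\<close> vanishes at j+k+1, its sum may run one further, to match the
    shifted sum of \<open>f\<close>.\<close>
  also have "\<dots> = (\<Sum>m\<le>j + k. f m * Q (Suc m)) + (\<Sum>m\<le>Suc (j + k). g m * Q m)"
    by (simp add: sum.distrib g_top)
  also have "\<dots> = (\<Sum>m\<le>Suc (j + k). h m * Q m)"
    unfolding sum.atMost_Suc_shift h_Suc h_0 by (simp add: sum.distrib distrib_right)
  also have "\<dots> = (1 - qvar ^ Suc k)^2 * (\<Sum>m\<le>j + Suc k. prod_coeff j (Suc k) m * Q m)"
    by (simp only: h_def sum_distrib_left mult_ac add_Suc_right)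
  finally show ?case
    using one_minus_qvar_power_nonzero[of k] by (simp del: power_Suc)
qed

section \<open>Positivity of the expansion coefficients\<close>

text \<open>This is M(j,k,m). The truncated \<open>m - j\<close> calls for the guard; the bounds k
  \<le> m and m \<le> j+k come from vanishing \<open>qbinom\<close> values.\<close>

definition nat_prod_coeff :: "nat \<Rightarrow> nat \<Rightarrow> nat \<Rightarrow> ratfun" where
  "nat_prod_coeff j k m = (if j \<le> m then qvar ^ ((m - j choose 2) + (m - k choose 2))
     * qbinom k (m - j) * qbinom (j + k) j * qbinom m k else 0)"

lemma nat_prod_coeff_nat_polys: "nat_prod_coeff j k m \<in> nat_polys"
  by (simp add: nat_prod_coeff_def nat_polys_0 nat_polys_mult nat_polys_qvar_power qbinom_nat_polys)

lemma twice_choose_two: "2 * int (n choose 2) = int n * (int n - 1)"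
  by (induction n) (simp_all add: numeral_2_eq_2 algebra_simps)

text \<open>On the support the q-factorials regroup into three q-binomials; off it both sides
  vanish.\<close>

lemma prod_coeff_eq_nat_prod_coeff: "prod_coeff j k m = qvar powi (- int (m choose 2)) * nat_prod_coeff j k m"
proof (cases "j \<le> m \<and> k \<le> m \<and> m \<le> j + k")
  case True
  define s t p where "s = m - j" and "t = m - k" and "p = j + k - m"
  have jkm: "j = t + p" "k = s + p" "m = s + t + p"
    using True by (auto simp: s_def t_def p_def)
  \<comment> \<open>Doubling turns the identity of exponents into a polynomial one in
    \<open>s\<close>, \<open>t\<close>, \<open>p\<close>.\<close>
  have "2 * (int (Suc j choose 2) + int (Suc k choose 2) - int (Suc m choose 2) - int p * int m)
      = 2 * (- int (m choose 2) + int (s choose 2) + int (t choose 2))"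
    unfolding right_diff_distrib distrib_left twice_choose_two mult_minus_right jkm
    by (simp add: algebra_simps)
  then have e: "int (Suc j choose 2) + int (Suc k choose 2) - int (Suc m choose 2) - int p * int m
      = - int (m choose 2) + int ((s choose 2) + (t choose 2))"
    by simp
  have ind: "int m - int j = int s" "int m - int k = int t" "int j + int k - int m = int p"
    "m - j = s" "m - k = t"
    by (simp_all add: jkm)
  have L: "prod_coeff j k m = qvar powi (- int (m choose 2)) * qvar ^ ((s choose 2) + (t choose 2))
     * qfact (j + k) * qfact m / (qfact j * qfact k)
     * inverse (qfact s) * inverse (qfact t) * inverse (qfact p)"
    unfolding prod_coeff_def ind e inv_qfact_of_nat
    by (simp only: power_int_add[OF disjI1[OF qvar_nonzero]] power_int_of_nat)
  have b: "qbinom k s = qfact k / (qfact s * qfact p)"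
    "qbinom (j + k) j = qfact (j + k) / (qfact j * qfact k)"
    "qbinom m k = qfact m / (qfact k * qfact t)"
    by (simp_all add: qbinom_def jkm)
  have M: "nat_prod_coeff j k m = qvar ^ ((s choose 2) + (t choose 2))
      * qbinom k s * qbinom (j + k) j * qbinom m k"
    using True by (simp add: nat_prod_coeff_def ind)
  show ?thesis
    unfolding L M b using qfact_nonzero by (simp add: divide_simps mult_ac)
next
  case False
  then show ?thesis
    by (auto simp: prod_coeff_def nat_prod_coeff_def inv_qfact_def qbinom_def)
qed

section \<open>The functions Q_k and their products\<close>

definition qbase :: "nat \<Rightarrow> nat \<Rightarrow> ratfun" where
  "qbase n k = qvar powi (int ((n - k) choose 2) - int (n choose 2)) * qbinom n k * qbinom (n + k) k"

lemma qbase_0: "qbase n 0 = 1"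
  by (simp add: qbase_def qbinom_def qfact_nonzero qfact_def[of 0])

lemma qbase_eq_0: "n < k \<Longrightarrow> qbase n k = 0"
  by (simp add: qbase_def qbinom_def)

text \<open>For k < n the ratio of neighbours is q^(k+1-n) (1 - q^(n-k)) (1 - q^(n+k+1)) / (1 -
  q^(k+1))^2; multiplied out, its numerator involves n only through q^(-n) + q^(n+1).\<close>

lemma qbase_Suc:
  "(1 - qvar ^ Suc k)^2 * qbase n (Suc k)
     = (qvar ^ Suc k * (qvar powi (- int n) + qvar ^ Suc n) - qvar ^ (2 * Suc k) - qvar) * qbase n k"
proof -
  consider "k < n" | "k = n" | "n < k" by linarith
  then show ?thesis
  proof cases
    case 1
    then obtain d where n: "n = k + Suc d"
      by (metis add_Suc_right less_imp_Suc_add)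
    have ineq: "k \<le> n" "Suc k \<le> n" "n - k = Suc d" "n - Suc k = d"
      by (simp_all add: n)
    define D K where "D = qvar ^ d" and "K = qvar ^ k"
    have nz: "D \<noteq> 0" "K \<noteq> 0" "qvar \<noteq> 0" by (simp_all add: D_def K_def qvar_nonzero)
    define E where "E = qvar powi (int (d choose 2) - int (n choose 2))"
    have "qvar ^ (2 * Suc k) = (qvar ^ Suc k)^2"
      by (rule power_even_eq)
    moreover have "qvar powi (- int n) = inverse (qvar ^ n)"
      by (simp add: power_int_minus)
    ultimately have pows: "qvar ^ Suc k = qvar * K" "qvar ^ (2 * Suc k) = (qvar * K)^2"
      "qvar powi (- int n) = 1 / (qvar * K * D)" "qvar ^ Suc n = qvar^2 * K * D"
      by (simp_all add: n K_def D_def power_add divide_inverse power2_eq_square mult_ac)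
    have nzs: "1 - qvar * K \<noteq> 0"
      using one_minus_qvar_power_nonzero[of k] by (simp add: K_def)
    have "qbase n (Suc k) = E * (qfact n / (qfact (Suc k) * qfact d))
        * (qfact (Suc (n + k)) / (qfact (Suc k) * qfact n))"
      by (simp add: qbase_def E_def qbinom_def ineq)
    also have "qfact (Suc (n + k)) = (1 - qvar^2 * K^2 * D) * qfact (n + k)"
      unfolding qfact_Suc by (simp add: n K_def D_def power_add power2_eq_square mult_ac)
    also have "qfact (Suc k) = (1 - qvar * K) * qfact k"
      unfolding qfact_Suc by (simp add: K_def)
    finally have Q1: "qbase n (Suc k) = E * (qfact n / ((1 - qvar * K) * qfact k * qfact d))
        * ((1 - qvar^2 * K^2 * D) * qfact (n + k) / ((1 - qvar * K) * qfact k * qfact n))" .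
    have "qbase n k = qvar powi (int (Suc d choose 2) - int (n choose 2))
        * (qfact n / (qfact k * qfact (Suc d))) * (qfact (n + k) / (qfact k * qfact n))"
      by (simp add: qbase_def qbinom_def ineq)
    also have "int (Suc d choose 2) - int (n choose 2) = int d + (int (d choose 2) - int (n choose 2))"
      by (simp add: numeral_2_eq_2)
    also have "qvar powi \<dots> = D * E"
      by (simp add: power_int_add qvar_nonzero D_def E_def)
    also have "qfact (Suc d) = (1 - qvar * D) * qfact d"
      unfolding qfact_Suc by (simp add: D_def)
    finally have Q0: "qbase n k = D * E * (qfact n / (qfact k * ((1 - qvar * D) * qfact d)))
        * (qfact (n + k) / (qfact k * qfact n))" .
    have nzd: "1 - qvar * D \<noteq> 0"
      using one_minus_qvar_power_nonzero[of d] by (simp add: D_def)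
    define G where "G = E * qfact (n + k) / (qfact k * qfact k * qfact d)"
    have Q1': "(1 - qvar * K)^2 * qbase n (Suc k) = G * (1 - qvar^2 * K^2 * D)"
      unfolding Q1 G_def using nzs qfact_nonzero[of n] qfact_nonzero[of k] qfact_nonzero[of d]
      by (simp add: divide_simps power2_eq_square)
    have Q0': "qbase n k = G * (D / (1 - qvar * D))"
      unfolding Q0 G_def using qfact_nonzero[of n] by (simp add: mult_ac)
    define W where "W = qvar * K * (1 / (qvar * K * D) + qvar^2 * K * D) - (qvar * K)^2 - qvar"
    \<comment> \<open>With D = q^(n-k-1) and K = q^k, the right side is (1 - q^(n-k)) (1 -
      q^(n+k+1)).\<close>
    have "W * D
        = (1 - qvar * D) * (1 - qvar^2 * K^2 * D)"
      unfolding W_def using nz by (simp add: divide_simps) (simp add: algebra_simps power2_eq_square)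
    then have "G * (1 - qvar^2 * K^2 * D) = W * (G * (D / (1 - qvar * D)))"
      using nzd by (simp add: eq_divide_eq)
    then show ?thesis
      unfolding pows Q1' Q0' W_def .
  next
    case 2
    \<comment> \<open>Here the factor 1 - q^(n-k) hidden in the bracket is zero.\<close>
    have "qvar ^ Suc n * (qvar powi (- int n) + qvar ^ Suc n) - qvar ^ (2 * Suc n) - qvar = 0"
      unfolding power_even_eq using qvar_nonzero
      by (simp add: power_int_minus field_simps power2_eq_square)
    then show ?thesis
      unfolding 2 by (simp add: qbase_eq_0)
  next
    case 3
    then show ?thesis by (simp add: qbase_eq_0)
  qed
qed

lemma qbase_mult:
  "qbase n j * qbase n k = (\<Sum>m\<le>n. qvar powi (- int (m choose 2)) * nat_prod_coeff j k m * qbase n m)"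
proof -
  have "qbase n j * qbase n k = (\<Sum>m\<le>j + k. prod_coeff j k m * qbase n m)"
    by (rule product_expansion[OF qbase_0 qbase_Suc])
  \<comment> \<open>The common upper bound n+(j+k) avoids comparing n with j+k: the coefficients
    vanish above j+k and \<open>qbase n\<close> above n.\<close>
  also have "\<dots> = (\<Sum>m\<le>n + (j + k). prod_coeff j k m * qbase n m)"
    by (rule sum.mono_neutral_left) (auto simp: prod_coeff_eq_0)
  also have "\<dots> = (\<Sum>m\<le>n. prod_coeff j k m * qbase n m)"
    by (rule sum.mono_neutral_right) (auto simp: qbase_eq_0)
  finally show ?thesis
    unfolding prod_coeff_eq_nat_prod_coeff .
qed

section \<open>Powers of Q_k\<close>

text \<open>These are the d(k,m) for r = s+1. The power of q makes up for replacing the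
  normalisation q^(-s C(j,2)) by q^(-s C(m,2)).\<close>

primrec power_coeff :: "nat \<Rightarrow> nat \<Rightarrow> nat \<Rightarrow> ratfun" where
  "power_coeff 0 k m = (if k = m then 1 else 0)"
| "power_coeff (Suc s) k m =
     (\<Sum>j\<le>m. power_coeff s k j * qvar ^ (s * ((m choose 2) - (j choose 2))) * nat_prod_coeff j k m)"

lemma power_coeff_nat_polys: "power_coeff s k m \<in> nat_polys"
  by (induction s arbitrary: m)
    (auto intro!: nat_polys_sum nat_polys_mult nat_polys_qvar_power nat_prod_coeff_nat_polys
      nat_polys_0 nat_polys_1)

lemma power_coeff_eq_0: "m < k \<Longrightarrow> power_coeff s k m = 0"
  by (cases s) (simp_all add: nat_prod_coeff_def qbinom_def)

lemma qbase_power: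
  assumes "k \<le> n"
  shows "qbase n k ^ Suc s
    = (\<Sum>m\<le>n. qvar powi (- (int s * int (m choose 2))) * power_coeff s k m * qbase n m)"
proof (induction s)
  case 0
  have "(\<Sum>m\<le>n. power_coeff 0 k m * qbase n m) = (\<Sum>m\<le>n. if m = k then qbase n m else 0)"
    by (intro sum.cong) auto
  with assms show ?case by simp
next
  case (Suc s)
  have exps: "qvar powi (- (int s * int (j choose 2))) * qvar powi (- int (m choose 2))
      = qvar powi (- (int (Suc s) * int (m choose 2))) * qvar ^ (s * ((m choose 2) - (j choose 2)))"
    if "j \<le> m" for j m
  proof -
    have "(j choose 2) \<le> (m choose 2)"
      using that by (rule binomial_right_mono)
    then have "- (int s * int (j choose 2)) + - int (m choose 2)
        = - (int (Suc s) * int (m choose 2)) + int (s * ((m choose 2) - (j choose 2)))"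
      by (simp add: of_nat_diff algebra_simps)
    then show ?thesis
      by (metis power_int_add power_int_of_nat qvar_nonzero)
  qed
  have "qbase n k ^ Suc (Suc s)
      = (\<Sum>j\<le>n. qvar powi (- (int s * int (j choose 2))) * power_coeff s k j * (qbase n j * qbase n k))"
    unfolding power_Suc2[of _ "Suc s"] Suc.IH sum_distrib_right by (simp only: mult.assoc)
  also have "\<dots> = (\<Sum>m\<le>n. \<Sum>j\<le>n. qvar powi (- (int s * int (j choose 2))) * power_coeff s k j
      * (qvar powi (- int (m choose 2)) * nat_prod_coeff j k m * qbase n m))"
    unfolding qbase_mult sum_distrib_left by (rule sum.swap)
  \<comment> \<open>Only j \<le> m contributes, which is what \<open>exps\<close> requires.\<close>
  also have "\<dots> = (\<Sum>m\<le>n. \<Sum>j\<le>m. qvar powi (- (int s * int (j choose 2))) * power_coeff s k j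
      * (qvar powi (- int (m choose 2)) * nat_prod_coeff j k m * qbase n m))"
    by (intro sum.cong[OF refl] sum.mono_neutral_right) (auto simp: nat_prod_coeff_def)
  also have "\<dots> = (\<Sum>m\<le>n. \<Sum>j\<le>m. qvar powi (- (int (Suc s) * int (m choose 2)))
      * (power_coeff s k j * qvar ^ (s * ((m choose 2) - (j choose 2))) * nat_prod_coeff j k m) * qbase n m)"
  proof (intro sum.cong refl)
    fix m j :: nat assume "j \<in> {..m}"
    then have "j \<le> m" by simp
    have "qvar powi (- (int s * int (j choose 2))) * power_coeff s k j
        * (qvar powi (- int (m choose 2)) * nat_prod_coeff j k m * qbase n m)
      = qvar powi (- (int s * int (j choose 2))) * qvar powi (- int (m choose 2))
        * (power_coeff s k j * nat_prod_coeff j k m * qbase n m)"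
      by (simp only: mult_ac)
    also have "\<dots> = qvar powi (- (int (Suc s) * int (m choose 2)))
      * (power_coeff s k j * qvar ^ (s * ((m choose 2) - (j choose 2))) * nat_prod_coeff j k m) * qbase n m"
      unfolding exps[OF \<open>j \<le> m\<close>] by (simp only: mult_ac)
    finally show "qvar powi (- (int s * int (j choose 2))) * power_coeff s k j
        * (qvar powi (- int (m choose 2)) * nat_prod_coeff j k m * qbase n m)
      = qvar powi (- (int (Suc s) * int (m choose 2)))
      * (power_coeff s k j * qvar ^ (s * ((m choose 2) - (j choose 2))) * nat_prod_coeff j k m) * qbase n m" .
  qed
  finally show ?case
    by (simp only: power_coeff.simps sum_distrib_left sum_distrib_right)
qed

section \<open>The explicit solution of the identities\<close>

text \<open>Both sides are q^C(n,2) times sums over \<open>qbase\<close>; summing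
  \<open>qbase_power\<close> over k and exchanging the sums matches them.\<close>

lemma schmidt_identity_power_coeff: "schmidt_identity (Suc s) (\<lambda>m. \<Sum>k\<le>m. power_coeff s k m) n"
proof -
  have lhs: "qvar powi (int (Suc s) * int ((n - k) choose 2) + (1 - int (Suc s)) * int (n choose 2))
      * qbinom n k ^ Suc s * qbinom (n + k) k ^ Suc s
    = qvar powi int (n choose 2) * qbase n k ^ Suc s" for k
  proof -
    have "int (Suc s) * int ((n - k) choose 2) + (1 - int (Suc s)) * int (n choose 2)
        = int (n choose 2) + (int ((n - k) choose 2) - int (n choose 2)) * int (Suc s)"
      by (simp add: algebra_simps)
    then show ?thesis
      unfolding qbase_def power_mult_distrib
      by (simp only: power_int_add[OF disjI1[OF qvar_nonzero]] power_int_mult power_int_of_nat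
          mult.assoc)
  qed
  have rhs: "qvar powi (int ((n - k) choose 2) + (1 - int (Suc s)) * int (k choose 2))
      * qbinom n k * qbinom (n + k) k * y
    = qvar powi int (n choose 2) * (qvar powi (- (int s * int (k choose 2))) * qbase n k * y)" for k y
  proof -
    have "int ((n - k) choose 2) + (1 - int (Suc s)) * int (k choose 2)
        = int (n choose 2) + (- (int s * int (k choose 2))
          + (int ((n - k) choose 2) - int (n choose 2)))"
      by (simp add: algebra_simps)
    then show ?thesis
      unfolding qbase_def
      by (simp only: power_int_add[OF disjI1[OF qvar_nonzero]] mult.assoc)
  qed
  have "(\<Sum>k\<le>n. qbase n k ^ Suc s)
      = (\<Sum>k\<le>n. \<Sum>m\<le>n. qvar powi (- (int s * int (m choose 2))) * power_coeff s k m * qbase n m)"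
    by (intro sum.cong refl qbase_power) simp
  also have "\<dots> = (\<Sum>m\<le>n. \<Sum>k\<le>n. qvar powi (- (int s * int (m choose 2))) * power_coeff s k m * qbase n m)"
    by (rule sum.swap)
  \<comment> \<open>Since d(k,m) = 0 for k > m, the inner sum of the d(k,m), and with it the
    solution, does not depend on n.\<close>
  also have "\<dots> = (\<Sum>m\<le>n. \<Sum>k\<le>m. qvar powi (- (int s * int (m choose 2))) * power_coeff s k m * qbase n m)"
    by (intro sum.cong[OF refl] sum.mono_neutral_right) (auto simp: power_coeff_eq_0)
  also have "\<dots> = (\<Sum>m\<le>n. qvar powi (- (int s * int (m choose 2))) * qbase n m
      * (\<Sum>k\<le>m. power_coeff s k m))"
    by (simp only: sum_distrib_left) (simp only: mult_ac)
  finally show ?thesis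
    unfolding schmidt_identity_def lhs rhs atLeast0AtMost sum_distrib_left[symmetric] by simp
qed

theorem theorem1p5:
  fixes r :: nat and c :: "nat \<Rightarrow> ratfun"
  assumes "r \<ge> 1"
    and "\<forall>n. schmidt_identity r c n"
  shows "\<forall>n. c n \<in> nat_polys"
proof -
  obtain s where "r = Suc s"
    using assms(1) by (cases r) auto
  \<comment> \<open>The identities have only one solution, so the given \<open>c\<close> is the
    explicit one.\<close>
  then have "c = (\<lambda>m. \<Sum>k\<le>m. power_coeff s k m)"
    using assms(2) schmidt_identity_power_coeff[of s] schmidt_identity_ex1[of r] by blast
  then show ?thesis
    by (simp add: nat_polys_sum power_coeff_nat_polys)
qed

end
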